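(* There is a set $P\subset\mathbb{N}$ which is an $\mathrm{IP}^*$-set and such that the spacing shift $\Omega_P$ is proximal and $h(\Omega_P)=0$.
   Context: $\mathbb{N}=\{1,2,\ldots\}$. For an infinite set $S=\{s_1<s_2<\ldots\}\subset\mathbb{N}$ let $\mathrm{FS}(S)=\{s_{n(1)}+\ldots+s_{n(k)}:n(1)<\ldots<n(k),\,k\in\mathbb{N}\}$. A set $A\subset\mathbb{N}$ is an $\mathrm{IP}$-set if it contains $\mathrm{FS}(S)$ for some infinite $S\subset\mathbb{N}$, and an $\mathrm{IP}^*$-set if it has nonempty intersection with every $\mathrm{IP}$-set. For $P\subset\mathbb{N}$ the spacing shift $\Omega_P$ is the set of all $\omega\in\{0,1\}^{\mathbb{N}}$ such that $\omega_i=\omega_j=1$ and $i\ne j$ imply $|i-j|\in P$; it is closed in $\{0,1\}^{\mathbb{N}}$ (product topology) and invariant under the shift $\sigma$, $(\sigma(\omega))_i=\omega_{i+1}$. $\Omega_P$ is proximal if $\liminf_{k\to\infty}\rho(\sigma^k(x),\sigma^k(y))=0$ for all $x,y\in \Omega_P$, where $\rho$ is any metric compatible with the topology. The topological entropy is $h(\Omega_P)=\lim_{k\to\infty}\frac1k\log\#\mathcal{L}_k(\Omega_P)$, where $\mathcal{L}_k(\Omega_P)$ is the set of words of length $k$ appearing in elements of $\Omega_P$ (logarithm base 2). *)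

theory Defs
  imports "HOL-Analysis.Analysis"
begin

text \<open>
  The natural numbers of the underlying text start at 1, so sets of natural numbers are sets
  \<^term>\<open>A :: nat set\<close> with \<^term>\<open>A \<subseteq> {1..}\<close>.
\<close>

definition FS :: "nat set \<Rightarrow> nat set" where
  "FS S = {\<Sum>F | F. F \<subseteq> S \<and> finite F \<and> F \<noteq> {}}"

definition IP_set :: "nat set \<Rightarrow> bool" where
  "IP_set A \<longleftrightarrow> A \<subseteq> {1..} \<and> (\<exists>S. S \<subseteq> {1..} \<and> infinite S \<and> FS S \<subseteq> A)"

definition IP_star_set :: "nat set \<Rightarrow> bool" where
  "IP_star_set A \<longleftrightarrow> A \<subseteq> {1..} \<and> (\<forall>B. IP_set B \<longrightarrow> A \<inter> B \<noteq> {})"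

text \<open>
  A 0-1 sequence is a function \<^typ>\<open>nat \<Rightarrow> bool\<close>, with \<^const>\<open>True\<close> for the symbol 1; the argument
  \<^term>\<open>i\<close> holds the coordinate of index \<^term>\<open>i + 1\<close>. Only differences of indices
  matter below.
\<close>

definition spacing_shift :: "nat set \<Rightarrow> (nat \<Rightarrow> bool) set" where
  "spacing_shift P = {w. \<forall>i j. w i \<and> w j \<and> i \<noteq> j \<longrightarrow> nat \<bar>int i - int j\<bar> \<in> P}"

definition shift :: "(nat \<Rightarrow> 'a) \<Rightarrow> (nat \<Rightarrow> 'a)" where
  "shift w = (\<lambda>i. w (Suc i))"

definition shift_topology :: "(nat \<Rightarrow> 'a) set \<Rightarrow> (nat \<Rightarrow> 'a) topology" where
  "shift_topology \<Omega> = subtopology (product_topology (\<lambda>_. discrete_topology UNIV) UNIV) \<Omega>"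

text \<open>
  Proximality of the system given by a map \<^term>\<open>T\<close> on a metrizable space \<^term>\<open>X\<close>, required for
  every compatible metric; metrizability ensures that the quantification is not vacuous.
\<close>

definition proximal :: "'a topology \<Rightarrow> ('a \<Rightarrow> 'a) \<Rightarrow> bool" where
  "proximal X T \<longleftrightarrow> metrizable_space X \<and>
     (\<forall>\<rho>. Metric_space (topspace X) \<rho> \<and> Metric_space.mtopology (topspace X) \<rho> = X \<longrightarrow>
       (\<forall>x\<in>topspace X. \<forall>y\<in>topspace X.
         liminf (\<lambda>k. ereal (\<rho> ((T ^^ k) x) ((T ^^ k) y))) = 0))"

definition language :: "nat \<Rightarrow> (nat \<Rightarrow> 'a) set \<Rightarrow> 'a list set" where
  "language k \<Omega> = {map w [i..<i + k] | w i. w \<in> \<Omega>}"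

definition entropy :: "(nat \<Rightarrow> 'a) set \<Rightarrow> real" where
  "entropy \<Omega> = lim (\<lambda>k. log 2 (real (card (language k \<Omega>))) / real k)"

lemma topspace_shift_topology [simp]: "topspace (shift_topology \<Omega>) = \<Omega>"
  by (simp add: shift_topology_def)

lemma shift_spacing_shift:
  assumes "w \<in> spacing_shift P"
  shows "shift w \<in> spacing_shift P"
proof -
  have "nat \<bar>int i - int j\<bar> \<in> P" if "w (Suc i)" "w (Suc j)" "i \<noteq> j" for i j
  proof -
    have "nat \<bar>int (Suc i) - int (Suc j)\<bar> \<in> P"
      using assms that unfolding spacing_shift_def by blast
    then show ?thesis by simp
  qed
  then show ?thesis by (simp add: spacing_shift_def shift_def)
qed

end

theory Submission
  imports Defs "HOL-Real_Asymp.Real_Asymp"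
begin

text \<open>
  Let \<open>R\<close> be the set of numbers with a single nonzero digit in the factorial number system, and let
  \<open>P\<close> be its complement. Distinct elements of \<open>R\<close> at a given distance are bounded, whereas an IP-set
  contains \<open>t\<close> and \<open>t + s\<close> for a fixed \<open>s\<close> and arbitrarily large \<open>t\<close>; so \<open>R\<close> contains no IP-set
  and \<open>P\<close> is an IP\<open>\<^sup>*\<close>-set. On the other hand \<open>R\<close> contains \<open>k!, 2 k!, \<dots>, k k!\<close>, so in a window
  of length \<open>(k + 1) k!\<close> a point of the spacing shift has at most one 1 in each residue class
  modulo \<open>k!\<close>. There are therefore at most \<open>(k + 2)\<^bsup>k!\<^esup>\<close> words of that length, which forces
  entropy 0, and two points have arbitrarily long common blocks of zeros, which gives proximality.
\<close>

section \<open>Factorial multiples and the IP* property\<close>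

text \<open>This is the set \<open>R\<close> above: in the factorial number system the digit at
  place \<open>k\<close> is at most \<open>k\<close>, hence the bounds on \<open>j\<close>.\<close>

definition factorial_multiples :: "nat set" where
  "factorial_multiples = {j * fact k | j k. 1 \<le> j \<and> j \<le> k}"

text \<open>The larger number has a place at least as high as that of \<open>a\<close>, so the
  factorial \<open>fact k\<close> in \<open>a\<close> divides both numbers and hence
  \<open>d\<close>. Thus \<open>k <= fact k <= d\<close>, while
  \<open>a <= k * fact k\<close>.\<close>

lemma factorial_multiples_gap:
  assumes "a \<in> factorial_multiples" and "a + d \<in> factorial_multiples" and "d > 0"
  shows "a \<le> d * fact d"
proof -
  obtain j k where a: "a = j * fact k" "1 \<le> j" "j \<le> k"
    using assms(1) unfolding factorial_multiples_def by blast
  obtain i l where b: "a + d = i * fact l" "1 \<le> i" "i \<le> l"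
    using assms(2) unfolding factorial_multiples_def by blast
  have "k \<le> l"
  proof (rule ccontr)
    assume "\<not> k \<le> l"
    then have "Suc l \<le> k" by simp
    then have "(fact (Suc l) :: nat) \<le> fact k" by (rule fact_mono_nat)
    moreover have "i * fact l < Suc l * fact l" using b(3) by (intro mult_strict_right_mono) auto
    moreover have "fact (Suc l) = Suc l * (fact l :: nat)" by (simp only: fact_Suc of_nat_id)
    moreover have "fact k \<le> a" using a(1,2) by simp
    ultimately show False using b(1) by linarith
  qed
  then have "fact k dvd i * fact l" by (simp add: fact_dvd)
  then have "fact k dvd a + d" by (simp only: b(1))
  moreover have "fact k dvd a" using a(1) by simp
  ultimately have "fact k dvd d" by (simp add: dvd_add_right_iff)
  then have "fact k \<le> d" using \<open>d > 0\<close> by (rule dvd_imp_le)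
  then have "k \<le> d" using fact_ge_self[of k] by linarith
  then show ?thesis unfolding a(1)
    by (intro mult_mono fact_mono_nat) (use a(3) in auto)
qed

lemma IP_star_set_compl_factorial_multiples: "IP_star_set ({1..} - factorial_multiples)"
  unfolding IP_star_set_def
proof (intro conjI allI impI)
  fix B assume "IP_set B"
  then obtain S where S: "B \<subseteq> {1..}" "S \<subseteq> {1..}" "infinite S" "FS S \<subseteq> B"
    unfolding IP_set_def by blast
  show "({1..} - factorial_multiples) \<inter> B \<noteq> {}"
  proof
    assume "({1..} - factorial_multiples) \<inter> B = {}"
    with S have sub: "FS S \<subseteq> factorial_multiples" by blast
    obtain s where s: "s \<in> S" using S(3) by fastforce
    \<comment> \<open>\<open>t > s\<close> makes \<open>{t, s}\<close> sum to \<open>t + s\<close>;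
      \<open>t > s * fact s\<close> contradicts the gap bound.\<close>
    obtain t where t: "t \<in> S" "t > max s (s * fact s)"
      using S(3) by (meson finite_nat_set_iff_bounded_le not_le)
    have "\<Sum>{t} \<in> FS S" "\<Sum>{t, s} \<in> FS S" unfolding FS_def using s t by blast+
    then have "t \<in> factorial_multiples" "t + s \<in> factorial_multiples"
      using sub t(2) by auto
    moreover have "s > 0" using s S(2) by auto
    ultimately show False using factorial_multiples_gap[of t s] t(2) by simp
  qed
qed auto

section \<open>Sparseness of ones and common zero blocks\<close>

abbreviation \<Omega> :: "(nat \<Rightarrow> bool) set" where
  "\<Omega> \<equiv> spacing_shift ({1..} - factorial_multiples)"

text \<open>Two ones in the same class would be at distance \<open>j * fact k\<close> with
  \<open>j >= 1\<close>, and the length of the window forces \<open>j <= k\<close>: a forbidden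
  distance.\<close>

lemma inj_on_mod_fact_ones:
  assumes "x \<in> \<Omega>"
  shows "inj_on (\<lambda>p. p mod fact k) {p. x p \<and> i \<le> p \<and> p < i + (k + 1) * fact k}"
proof (rule linorder_inj_onI)
  fix p q :: nat
  assume "p < q" and p: "p \<in> {p. x p \<and> i \<le> p \<and> p < i + (k + 1) * fact k}"
    and q: "q \<in> {p. x p \<and> i \<le> p \<and> p < i + (k + 1) * fact k}"
  show "p mod fact k \<noteq> q mod fact k"
  proof
    assume "p mod fact k = q mod fact k"
    then have "fact k dvd q - p" using \<open>p < q\<close> by (metis mod_eq_dvd_iff_nat less_imp_le)
    then obtain j where j: "q - p = fact k * j" by (auto elim: dvdE)
    have "q - p < (k + 1) * fact k" using p q \<open>p < q\<close> by (simp only: mem_Collect_eq) linarith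
    then have "fact k * j < fact k * (k + 1)" by (metis j mult.commute)
    then have "j < k + 1" by (simp only: nat_mult_less_cancel_disj)
    then have "j \<le> k" by simp
    moreover have "1 \<le> j" using j \<open>p < q\<close> by (cases j) auto
    ultimately have "q - p \<in> factorial_multiples"
      unfolding factorial_multiples_def using j by (auto simp: mult.commute)
    moreover have "nat \<bar>int q - int p\<bar> \<in> {1..} - factorial_multiples"
      using assms p q \<open>p < q\<close> unfolding spacing_shift_def mem_Collect_eq by blast
    moreover have "nat \<bar>int q - int p\<bar> = q - p" using \<open>p < q\<close> by simp
    ultimately show False by (metis DiffD2)
  qed
qed auto

lemma card_ones_le:
  assumes "x \<in> \<Omega>"
  shows "card {p. x p \<and> i \<le> p \<and> p < i + (k + 1) * fact k} \<le> fact k"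
proof -
  have "card {p. x p \<and> i \<le> p \<and> p < i + (k + 1) * fact k} \<le> card {..<fact k :: nat}"
    by (rule card_inj_on_le[OF inj_on_mod_fact_ones[OF assms]]) auto
  then show ?thesis by simp
qed

text \<open>Pigeonhole: \<open>x\<close> and \<open>y\<close> together have at most
  \<open>2 * fact k\<close> ones in a window that is cut into \<open>3 * fact k\<close> blocks of
  length \<open>L\<close>.\<close>

lemma common_zero_block:
  assumes "x \<in> \<Omega>" and "y \<in> \<Omega>" and "L > 0"
  shows "\<exists>m\<ge>i. \<forall>j<L. \<not> x (m + j) \<and> \<not> y (m + j)"
proof -
  \<comment> \<open>Chosen so that the window length \<open>(k + 1) * N\<close> equals
    \<open>3 * N\<close> blocks of length \<open>L\<close>.\<close>
  define k where "k = 3 * L - 1"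
  have k: "k + 1 = 3 * L" using \<open>L > 0\<close> by (simp add: k_def)
  define N :: nat where "N = fact k"
  define W where "W z = {p. z p \<and> i \<le> p \<and> p < i + (k + 1) * N}" for z
  have "finite (W z)" for z
    by (rule finite_subset[of _ "{..<i + (k + 1) * N}"]) (auto simp: W_def)
  have "card (W x \<union> W y) \<le> N + N"
    using card_ones_le[OF assms(1), of i k] card_ones_le[OF assms(2), of i k] card_Un_le[of "W x" "W y"]
    unfolding W_def N_def by linarith
  moreover have "N > 0" by (simp add: N_def)
  \<comment> \<open>\<open>(p - i) div L\<close> is the index of the block containing
    \<open>p\<close>; the image collects the blocks that meet a 1.\<close>
  moreover have "card ((\<lambda>p. (p - i) div L) ` (W x \<union> W y)) \<le> card (W x \<union> W y)"
    using \<open>\<And>z. finite (W z)\<close> by (intro card_image_le) auto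
  ultimately have "card ((\<lambda>p. (p - i) div L) ` (W x \<union> W y)) < card {..<3 * N}" by simp
  then have "\<not> {..<3 * N} \<subseteq> (\<lambda>p. (p - i) div L) ` (W x \<union> W y)"
    using \<open>\<And>z. finite (W z)\<close> by (meson card_mono finite_UnI finite_imageI not_le)
  then obtain b where b: "b < 3 * N" "b \<notin> (\<lambda>p. (p - i) div L) ` (W x \<union> W y)" by auto
  have "i + b * L + j \<notin> W x \<union> W y" if "j < L" for j
    using b(2) that by (auto intro: rev_image_eqI)
  moreover have "i + b * L + j < i + (k + 1) * N" if "j < L" for j
  proof -
    have "b * L + j < (b + 1) * L" using that by simp
    also have "\<dots> \<le> 3 * N * L" using b(1) by (intro mult_right_mono) auto
    finally show ?thesis unfolding k by (simp add: algebra_simps)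
  qed
  ultimately have "\<forall>j<L. \<not> x (i + b * L + j) \<and> \<not> y (i + b * L + j)"
    by (auto simp: W_def)
  then show ?thesis by (intro exI[of _ "i + b * L"]) simp
qed

section \<open>Proximality from common constant blocks\<close>

lemma shift_funpow: "(shift ^^ k) x = (\<lambda>i. x (k + i))"
  by (induction k arbitrary: x) (auto simp: shift_def funpow_swap1)

lemma metrizable_shift_topology: "metrizable_space (shift_topology X)"
  unfolding shift_topology_def
  by (intro metrizable_space_subtopology)
     (auto simp: metrizable_space_product_topology metrizable_space_discrete_topology)

text \<open>A basic open set constrains only finitely many coordinates, so \<open>L\<close> can be
  taken beyond all of them.\<close>

lemma shift_topology_nhd_cylinder:
  assumes "openin (shift_topology X) U" and "x \<in> U"
  shows "\<exists>L. \<forall>w\<in>X. (\<forall>i<L. w i = x i) \<longrightarrow> w \<in> U"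
proof -
  obtain V where V: "openin (product_topology (\<lambda>_::nat. discrete_topology UNIV) UNIV) V" "U = V \<inter> X"
    using assms(1) unfolding shift_topology_def openin_subtopology by blast
  then obtain B where B: "finite {i. B i \<noteq> UNIV}" "x \<in> PiE UNIV B" "PiE UNIV B \<subseteq> V"
    using assms(2) unfolding openin_product_topology_alt by auto
  obtain L where L: "\<forall>i\<in>{i. B i \<noteq> UNIV}. i < L"
    using B(1) finite_nat_set_iff_bounded by blast
  show ?thesis
  proof (intro exI[of _ L] ballI impI)
    fix w assume "w \<in> X" and eq: "\<forall>i<L. w i = x i"
    have "w i \<in> B i" for i
      using L eq B(2) by (cases "i < L") (auto simp: PiE_iff)
    then show "w \<in> U" using B(3) V(2) \<open>w \<in> X\<close> by auto
  qed
qed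

text \<open>At the start of a long common block both orbits are close to the constant sequence,
  hence to each other by the triangle inequality.\<close>

lemma proximal_shift_if_common_constant_blocks:
  fixes X :: "(nat \<Rightarrow> 'a) set"
  assumes inv: "\<And>w. w \<in> X \<Longrightarrow> shift w \<in> X" and const: "(\<lambda>_. c) \<in> X"
    and block: "\<And>x y L n. x \<in> X \<Longrightarrow> y \<in> X \<Longrightarrow> \<exists>k\<ge>n. \<forall>j<L. x (k + j) = c \<and> y (k + j) = c"
  shows "proximal (shift_topology X) shift"
  unfolding proximal_def topspace_shift_topology
proof (intro conjI allI impI ballI metrizable_shift_topology)
  fix \<rho> x y
  assume \<rho>: "Metric_space X \<rho> \<and> Metric_space.mtopology X \<rho> = shift_topology X"
    and x: "x \<in> X" and y: "y \<in> X"
  interpret Metric_space X \<rho> using \<rho> by blast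
  define z :: "nat \<Rightarrow> 'a" where "z = (\<lambda>_. c)"
  have z: "z \<in> X" using const by (simp add: z_def)
  have inv_pow: "(shift ^^ k) w \<in> X" if "w \<in> X" for k w
    by (induction k) (auto intro: inv that)
  let ?d = "\<lambda>k. \<rho> ((shift ^^ k) x) ((shift ^^ k) y)"
  have close: "\<exists>k\<ge>n. ?d k < e" if "e > 0" for e n
  proof -
    \<comment> \<open>The metric is arbitrary, so closeness is available only through its balls
      being open in the product topology.\<close>
    have "openin (shift_topology X) (mball z (e / 2))"
      using \<rho> by (metis openin_mball)
    moreover have "z \<in> mball z (e / 2)" using z that by simp
    ultimately obtain L where L: "\<forall>w\<in>X. (\<forall>i<L. w i = z i) \<longrightarrow> w \<in> mball z (e / 2)"
      by (metis shift_topology_nhd_cylinder)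
    obtain k where k: "k \<ge> n" "\<forall>j<L. x (k + j) = c \<and> y (k + j) = c"
      using block[OF x y] by blast
    have "(shift ^^ k) x \<in> mball z (e / 2)" "(shift ^^ k) y \<in> mball z (e / 2)"
      using k(2) x y by (intro L[rule_format] inv_pow; simp add: shift_funpow z_def)+
    then have "\<rho> z ((shift ^^ k) x) < e / 2" "\<rho> z ((shift ^^ k) y) < e / 2" by auto
    moreover have "?d k \<le> \<rho> ((shift ^^ k) x) z + \<rho> z ((shift ^^ k) y)"
      using inv_pow x y z by (intro triangle) auto
    ultimately have "?d k < e" by (simp add: commute)
    with k(1) show ?thesis by blast
  qed
  show "liminf (\<lambda>k. ereal (?d k)) = 0"
  proof (rule antisym)
    show "liminf (\<lambda>k. ereal (?d k)) \<le> 0"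
    proof (rule ereal_le_epsilon2)
      fix e :: real assume "e > 0"
      show "liminf (\<lambda>k. ereal (?d k)) \<le> 0 + ereal e"
        unfolding liminf_SUP_INF
      proof (rule SUP_least)
        fix n
        obtain k where "k \<ge> n" "?d k < e" using close \<open>e > 0\<close> by blast
        then show "(INF k\<in>{n..}. ereal (?d k)) \<le> 0 + ereal e"
          by (intro INF_lower2[of k]) auto
      qed
    qed
    show "0 \<le> liminf (\<lambda>k. ereal (?d k))" by (rule Liminf_bounded) simp
  qed
qed

lemma zero_in_spacing_shift: "(\<lambda>_. False) \<in> spacing_shift P"
  by (simp add: spacing_shift_def)

lemma proximal_Omega: "proximal (shift_topology \<Omega>) shift"
proof (rule proximal_shift_if_common_constant_blocks[where c = False])
  show "\<exists>k\<ge>n. \<forall>j<L. x (k + j) = False \<and> y (k + j) = False"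
    if "x \<in> \<Omega>" "y \<in> \<Omega>" for x y L n
    \<comment> \<open>\<open>Suc L\<close> because the block lemma needs a positive length and
      \<open>L\<close> may be 0.\<close>
    using common_zero_block[OF that, of "Suc L" n] by auto
qed (rule shift_spacing_shift zero_in_spacing_shift; assumption?)+

section \<open>Zero entropy\<close>

text \<open>A special case of Fekete's lemma: one good length \<open>m\<close> controls every
  \<open>n = q * m + r\<close>, since the remainder \<open>r < m\<close> contributes a bounded
  amount.\<close>

lemma subadditive_div_tendsto_zero:
  fixes a :: "nat \<Rightarrow> real"
  assumes nonneg: "\<And>n. 0 \<le> a n" and subadd: "\<And>m n. a (m + n) \<le> a m + a n"
    and small: "\<And>e. e > 0 \<Longrightarrow> \<exists>m>0. a m \<le> e * real m"
  shows "(\<lambda>n. a n / real n) \<longlonglongrightarrow> 0"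
proof (rule order_tendstoI)
  fix e :: real assume "e > 0"
  then obtain m where m: "m > 0" "a m \<le> e / 2 * real m" using small[of "e / 2"] by auto
  have mult: "a (q * m + r) \<le> real q * a m + a r" for q r
  proof (induction q)
    case (Suc q)
    have "a (Suc q * m + r) \<le> a m + a (q * m + r)"
      using subadd[of m "q * m + r"] by (simp add: add.assoc)
    with Suc show ?case by (simp add: algebra_simps)
  qed simp
  \<comment> \<open>By nonnegativity the sum dominates \<open>a r\<close> for every remainder
    \<open>r < m\<close>.\<close>
  define C where "C = sum a {..<m}"
  have bound: "a n \<le> e / 2 * real n + C" for n
  proof -
    have "a n \<le> real (n div m) * a m + a (n mod m)" using mult[of "n div m" "n mod m"] by simp
    also have "\<dots> \<le> real (n div m) * (e / 2 * real m) + C"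
      unfolding C_def using m nonneg by (intro add_mono mult_left_mono member_le_sum) auto
    also have "real (n div m) * (e / 2 * real m) = e / 2 * real (n div m * m)" by simp
    also have "\<dots> \<le> e / 2 * real n" using \<open>e > 0\<close>
      by (intro mult_left_mono of_nat_mono div_times_less_eq_dividend) auto
    finally show ?thesis by simp
  qed
  have "(\<lambda>n. C / real n) \<longlonglongrightarrow> 0" by real_asymp
  then have "\<forall>\<^sub>F n in sequentially. C / real n < e / 2"
    using \<open>e > 0\<close> by (intro order_tendstoD) auto
  then show "\<forall>\<^sub>F n in sequentially. a n / real n < e"
    using eventually_gt_at_top[of 0]
  proof eventually_elim
    case (elim n)
    then show ?case using bound[of n] by (simp add: field_simps)
  qed
next
  fix e :: real assume "e < 0"
  then show "\<forall>\<^sub>F n in sequentially. e < a n / real n"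
    using nonneg by (intro always_eventually allI) (meson divide_nonneg_nonneg less_le_trans of_nat_0_le_iff)
qed

lemma finite_language: "finite (language n (X :: (nat \<Rightarrow> bool) set))"
  by (rule finite_subset[OF _ finite_lists_length_eq[of UNIV n]]) (auto simp: language_def)

lemma card_language_add:
  fixes X :: "(nat \<Rightarrow> bool) set"
  shows "card (language (m + n) X) \<le> card (language m X) * card (language n X)"
proof -
  have "language (m + n) X \<subseteq> (\<lambda>(u, v). u @ v) ` (language m X \<times> language n X)"
  proof
    fix u assume "u \<in> language (m + n) X"
    then obtain w i where w: "w \<in> X" "u = map w [i..<i + (m + n)]" unfolding language_def by blast
    have "u = map w [i..<i + m] @ map w [i + m..<(i + m) + n]"
      unfolding w(2) by (metis add.assoc le_add1 map_append upt_add_eq_append)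
    moreover have "map w [i..<i + m] \<in> language m X" "map w [i + m..<(i + m) + n] \<in> language n X"
      using w(1) unfolding language_def by blast+
    ultimately show "u \<in> (\<lambda>(u, v). u @ v) ` (language m X \<times> language n X)" by force
  qed
  then have "card (language (m + n) X) \<le> card (language m X \<times> language n X)"
    by (rule surj_card_le[OF finite_cartesian_product[OF finite_language finite_language]])
  then show ?thesis by (simp add: card_cartesian_product)
qed

lemma funpow_shift_spacing_shift:
  "w \<in> spacing_shift P \<Longrightarrow> (shift ^^ k) w \<in> spacing_shift P"
  by (induction k) (auto intro: shift_spacing_shift)

text \<open>With at most one 1 per residue class, a word is coded by one of \<open>k + 2\<close>
  values for each of the \<open>fact k\<close> classes.\<close>

lemma card_language_Omega_le:
  "card (language ((k + 1) * fact k) \<Omega>) \<le> (k + 2) ^ fact k"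
proof -
  define N :: nat where "N = fact k"
  have "N > 0" by (simp add: N_def)
  let ?F = "PiE {..<N} (\<lambda>_. {..k + 1})"
  \<comment> \<open>\<open>f r\<close> is the index of the only 1 in the residue class \<open>r\<close>, and \<open>k + 1\<close> if there is none.\<close>
  define g where "g f = map (\<lambda>p. f (p mod N) = p div N) [0..<(k + 1) * N]" for f :: "nat \<Rightarrow> nat"
  have "language ((k + 1) * N) \<Omega> \<subseteq> g ` ?F"
  proof
    fix u assume "u \<in> language ((k + 1) * N) \<Omega>"
    then obtain w i where w: "w \<in> \<Omega>" "u = map w [i..<i + (k + 1) * N]" unfolding language_def by blast
    \<comment> \<open>Moving the word to the origin lets classes and quotients be computed from
      \<open>p\<close> without the offset \<open>i\<close>.\<close>
    define y where "y = (shift ^^ i) w"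
    have y: "y \<in> \<Omega>" unfolding y_def by (rule funpow_shift_spacing_shift[OF w(1)])
    have u: "u = map y [0..<(k + 1) * N]"
      unfolding w(2) y_def shift_funpow by (rule nth_equalityI) auto
    define f where "f = restrict (\<lambda>r. if \<exists>j\<le>k. y (r + N * j) then SOME j. j \<le> k \<and> y (r + N * j)
      else k + 1) {..<N}"
    have some: "f r \<le> k \<and> y (r + N * f r)" if "\<exists>j\<le>k. y (r + N * j)" "r < N" for r
      using someI_ex[of "\<lambda>j. j \<le> k \<and> y (r + N * j)"] that by (auto simp: f_def)
    have none: "f r = k + 1" if "\<not> (\<exists>j\<le>k. y (r + N * j))" "r < N" for r
      using that by (auto simp: f_def)
    have "f r \<le> k + 1" if "r < N" for r
      using some[of r] none[of r] that by fastforce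
    then have "f \<in> ?F" by (auto simp: PiE_iff f_def)
    moreover have "y p \<longleftrightarrow> f (p mod N) = p div N" if p: "p < (k + 1) * N" for p
    proof -
      have r: "p mod N < N" using \<open>N > 0\<close> by simp
      have "p div N < k + 1" using p by (simp add: less_mult_imp_div_less)
      then have div: "p div N \<le> k" by simp
      show ?thesis
      proof
        assume "y p"
        with div have "\<exists>j\<le>k. y (p mod N + N * j)" by (intro exI[of _ "p div N"]) simp
        note f = some[OF this r]
        have "p mod N + N * f (p mod N) < N + N * k"
          using r f by (intro add_less_le_mono) auto
        also have "\<dots> = 0 + (k + 1) * N" by simp
        finally have bound: "p mod N + N * f (p mod N) < 0 + (k + 1) * N" .
        have "p mod N + N * f (p mod N) = p"
        \<comment> \<open>The position picked by \<open>SOME\<close> and \<open>p\<close> are ones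
          of the same class in one window, so injectivity identifies them.\<close>
        proof (rule inj_onD[OF inj_on_mod_fact_ones[OF y, of k 0, folded N_def]])
          show "(p mod N + N * f (p mod N)) mod N = p mod N" by simp
          show "p mod N + N * f (p mod N) \<in> {p. y p \<and> 0 \<le> p \<and> p < 0 + (k + 1) * N}"
            using f bound by blast
          show "p \<in> {p. y p \<and> 0 \<le> p \<and> p < 0 + (k + 1) * N}"
            using \<open>y p\<close> p by simp
        qed
        then have "N * f (p mod N) = N * (p div N)"
          by (metis add_left_cancel mod_mult_div_eq)
        then show "f (p mod N) = p div N" using \<open>N > 0\<close> by simp
      next
        assume eq: "f (p mod N) = p div N"
        \<comment> \<open>The value \<open>p div N\<close> is at most \<open>k\<close>, so it is not
          the default \<open>k + 1\<close> and the class does contain a 1.\<close>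
        with none[OF _ r] div have "\<exists>j\<le>k. y (p mod N + N * j)" by fastforce
        from some[OF this r] show "y p" by (simp add: eq)
      qed
    qed
    then have "u = g f" by (simp add: u g_def)
    ultimately show "u \<in> g ` ?F" by blast
  qed
  then have "card (language ((k + 1) * N) \<Omega>) \<le> card ?F"
    by (rule surj_card_le[rotated]) (auto intro: finite_PiE)
  then show ?thesis by (simp add: card_PiE N_def)
qed

text \<open>Subadditivity reduces the limit to the lengths \<open>(k + 1) * fact k\<close>, where
  the rate is at most \<open>log 2 (k + 2) / (k + 1)\<close>. Convergence has to be shown because
  \<open>entropy\<close> is defined by \<open>lim\<close>.\<close>

lemma entropy_Omega: "entropy \<Omega> = 0"
proof -
  let ?c = "\<lambda>n. card (language n \<Omega>)"
  have pos: "?c n > 0" for n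
  proof -
    have "map (\<lambda>_. False) [0..<0 + n] \<in> language n \<Omega>"
      unfolding language_def using zero_in_spacing_shift by blast
    then show ?thesis using finite_language by (auto simp: card_gt_0_iff)
  qed
  have "(\<lambda>n. log 2 (real (?c n)) / real n) \<longlonglongrightarrow> 0"
  proof (rule subadditive_div_tendsto_zero)
    show "0 \<le> log 2 (real (?c n))" for n using pos[of n] by simp
    show "log 2 (real (?c (m + n))) \<le> log 2 (real (?c m)) + log 2 (real (?c n))" for m n
    proof -
      have "log 2 (real (?c (m + n))) \<le> log 2 (real (?c m * ?c n))"
        using card_language_add pos by (intro log_mono of_nat_mono) auto
      then show ?thesis using pos by (simp add: log_mult)
    qed
    show "\<exists>m>0. log 2 (real (?c m)) \<le> e * real m" if "e > 0" for e
    proof -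
      have "(\<lambda>k. log 2 (real k + 2) / (real k + 1)) \<longlonglongrightarrow> 0" by real_asymp
      then have "\<forall>\<^sub>F k in sequentially. log 2 (real k + 2) / (real k + 1) < e"
        using that by (intro order_tendstoD) auto
      then obtain k where "log 2 (real k + 2) / (real k + 1) < e"
        by (auto simp: eventually_sequentially)
      then have k: "log 2 (real k + 2) \<le> e * (real k + 1)" by (simp add: field_simps)
      have "log 2 (real (?c ((k + 1) * fact k))) \<le> log 2 (real ((k + 2) ^ fact k))"
        using card_language_Omega_le pos by (intro log_mono of_nat_mono) auto
      also have "\<dots> = fact k * log 2 (real k + 2)"
        by (simp add: log_nat_power add.commute)
      also have "\<dots> \<le> fact k * (e * (real k + 1))" using k by (intro mult_left_mono) auto
      also have "\<dots> = e * real ((k + 1) * fact k)" by (simp add: algebra_simps)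
      finally show ?thesis by (intro exI[of _ "(k + 1) * fact k"]) simp
    qed
  qed
  then show ?thesis unfolding entropy_def by (rule limI)
qed

theorem corollary19:
  "\<exists>P :: nat set. IP_star_set P
     \<and> proximal (shift_topology (spacing_shift P)) shift
     \<and> entropy (spacing_shift P) = 0"
  using IP_star_set_compl_factorial_multiples proximal_Omega entropy_Omega by blast

end
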